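(* Let $\mathbb{H}\subseteq\mathbb{W}^N\times\mathbb{D}$ be a nonempty set of uncertainties, of arbitrary (possibly uncountable) cardinality. The robust optimal control problem $$\mathcal{P}_N(\mathbb{H}):\quad \min_{\mathbf q,r,\,(\mathbf x^i,\mathbf u^i)_{i\in\mathbb{J}}}\ \max_{i\in\mathbb{J}}\ J_N(\mathbf x^i,\mathbf u^i,\mathbf w^i,d^i)$$ $$\text{s.t. } g_k(x^i_k,u^i_k,w^i_k,d^i)\le 0\ \ \forall i\in\mathbb{J},\ k=0,\dots,N-1,\qquad (\mathbf x^i,\mathbf u^i)=\mathbf z(\mathbf q,r,\mathbf w^i,d^i)\ \ \forall i\in\mathbb{J},$$ where $\mathbb{H}=\{(\mathbf w^i,d^i): i\in\mathbb{J}\}$ is indexed by a set $\mathbb{J}$ of cardinality $\operatorname{card}\mathbb{H}$, is equivalent to the semi-infinite optimization problem $$\min_{\theta\in\mathcal{A}} Q(\theta)\quad\text{s.t. } R(\theta,\rho)\le 0\ \text{ for all }\rho\in\mathcal{B}$$ with $\theta:=(\mathbf q,r,\gamma)$, where $\gamma$ is an additional scalar parameter characterizing the cost upper bound, $\rho:=(\mathbf w,d)$, $\mathcal{A}:=\mathbb{R}^{n_q}\times\mathbb{R}^{n_r}\times\mathbb{R}$, $\mathcal{B}:=\mathbb{H}$, $Q(\theta):=\gamma$ and $R(\theta,\rho):=G(\mathbf z(\mathbf q,r,\mathbf w,d),\mathbf w,d,\gamma)$. Here "equivalent" means: the two problems have the same optimal value (infimum), and $(\mathbf q,r)$, together with the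 trajectories $(\mathbf x^i,\mathbf u^i)=\mathbf z(\mathbf q,r,\mathbf w^i,d^i)$, $i\in\mathbb{J}$, is a minimizer with finite cost of $\mathcal{P}_N(\mathbb{H})$ if and only if there is $\gamma\in\mathbb{R}$ such that $(\mathbf q,r,\gamma)$ is a minimizer of the semi-infinite problem.
   Context: Setting. $N\ge 1$ is an integer horizon; $\mathbb{W}\subset\mathbb{R}^{n_w}$ and $\mathbb{D}\subset\mathbb{R}^{n_d}$ are nonempty compact sets; $\mathbb{W}^N=\mathbb{W}\times\cdots\times\mathbb{W}$. The system is $x_{k+1}=f_k(x_k,u_k,w_k,d)$, $x_0=\hat x$ (given), with state $x_k\in\mathbb{R}^{n_x}$, control $u_k\in\mathbb{R}^{n_u}$, time-varying uncertainty $w_k\in\mathbb{W}$, constant uncertainty $d\in\mathbb{D}$, and $f_k$ continuously differentiable. The control is given by a causal feedback policy $u_k=\pi_k(x_0,\dots,x_k;q_0,\dots,q_k,r)$ of fixed structure with parameters $\mathbf q=(q_0,\dots,q_{N-1})\in\mathbb{R}^{n_q}$ and $r\in\mathbb{R}^{n_r}$. Write $\mathbf x=(x_0,\dots,x_N)$, $\mathbf u=(u_0,\dots,u_{N-1})$, $\mathbf w=(w_0,\dots,w_{N-1})\in\mathbb{W}^N$. For given $(\mathbf q,r,\mathbf w,d)$, $\mathbf z(\mathbf q,r,\mathbf w,d)$ denotes the unique trajectory $(\mathbf x,\mathbf u)$ with $x_0=\hat x$, $x_{k+1}=f_k(x_k,u_k,w_k,d)$, $u_k=\pi_k(x_0,\dots,x_k;q_0,\dots,q_k,r)$,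 $k=0,\dots,N-1$. Trajectories are assumed bounded over the finite horizon. Cost: $J_N(\mathbf x,\mathbf u,\mathbf w,d)=J_f(x_N,\mathbf w,d)+\sum_{k=0}^{N-1}\ell_k(x_k,u_k,w_k,d)$ with $J_f,\ell_k$ real-valued and continuously differentiable. Constraints: $g_k$, $k=0,\dots,N-1$, are continuously differentiable with values in $\mathbb{R}^{n_g}$, and $g_k\le 0$ is meant componentwise. With $e_h$ the $h$-th column of the $n_g\times n_g$ identity matrix, define $$G(\mathbf x,\mathbf u,\mathbf w,d,\gamma):=\max\Big\{\max_{1\le h\le n_g,\ 0\le k\le N-1} e_h^{T}g_k(x_k,u_k,w_k,d),\ J_N(\mathbf x,\mathbf u,\mathbf w,d)-\gamma\Big\}.$$ Conventions: min and max in the problems are read as infimum and supremum when not attained; the infimum over an empty feasible set is $+\infty$. A minimizer is a feasible point whose cost equals the infimum. *)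

theory Defs
  imports "HOL-Analysis.Analysis" "HOL-Library.Equipollence"
begin

section \<open>Generic minimisation notions\<close>

text \<open>Costs are extended reals, so that a supremum may be infinite and the infimum over an
  empty feasible set is \<open>\<infinity>\<close>.\<close>

definition optimal_value :: "'s set \<Rightarrow> ('s \<Rightarrow> ereal) \<Rightarrow> ereal" where
  "optimal_value F c = (INF s\<in>F. c s)"

definition is_minimizer :: "'s set \<Rightarrow> ('s \<Rightarrow> ereal) \<Rightarrow> 's \<Rightarrow> bool" where
  "is_minimizer F c s \<longleftrightarrow> s \<in> F \<and> c s = optimal_value F c"

definition sip_feasible :: "'t set \<Rightarrow> 'p set \<Rightarrow> ('t \<Rightarrow> 'p \<Rightarrow> real) \<Rightarrow> 't set" where
  "sip_feasible A B R = {\<theta>\<in>A. \<forall>\<rho>\<in>B. R \<theta> \<rho> \<le> 0}"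

definition continuously_differentiable ::
    "('a::real_normed_vector \<Rightarrow> 'b::real_normed_vector) \<Rightarrow> bool" where
  "continuously_differentiable F \<longleftrightarrow>
     (\<exists>F' :: 'a \<Rightarrow> 'a \<Rightarrow>\<^sub>L 'b.
        (\<forall>p. (F has_derivative blinfun_apply (F' p)) (at p)) \<and> continuous_on UNIV F')"


section \<open>Robust optimal control problems\<close>

text \<open>The type \<open>'t\<close> is a finite linear order whose elements are the time instants
  \<open>0, \<dots>, N - 1\<close> in increasing order; the horizon is \<open>N = CARD('t)\<close>, and every \<open>N \<ge> 1\<close> arises in
  this way.  An uncertainty sequence
  \<open>(w\<^sub>0, \<dots>, w\<^sub>N\<^sub>-\<^sub>1)\<close> is an element of \<open>(real^'nw)^'t\<close>, so that the space of these
  sequences is normed, as needed for differentiability of the terminal cost.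

  The parameter \<open>q = (q\<^sub>0, \<dots>, q\<^sub>N\<^sub>-\<^sub>1)\<close> is a vector of \<open>real^'nq\<close>; its blocks \<open>q\<^sub>k\<close>, which may
  have different dimensions, consist of the coordinates \<open>j\<close> with \<open>q_block j = k\<close>.

  A policy receives the tuples \<open>(x\<^sub>0, \<dots>, x\<^sub>k)\<close> and \<open>(q\<^sub>0, \<dots>, q\<^sub>k)\<close> as functions restricted to the
  corresponding index sets, so that causality holds by construction.\<close>

type_synonym ('nw, 't) wseq = "(real^'nw, 't) vec"
type_synonym ('nx, 'nu) traj = "(nat \<Rightarrow> real^'nx) \<times> (nat \<Rightarrow> real^'nu)"

record ('nx, 'nu, 'nw, 'nd, 'nq, 'nr, 'ng, 't) rocp =
  dyn        :: "nat \<Rightarrow> real^'nx \<Rightarrow> real^'nu \<Rightarrow> real^'nw \<Rightarrow> real^'nd \<Rightarrow> real^'nx"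
  init       :: "real^'nx"
  q_block    :: "'nq \<Rightarrow> nat"
  policy     :: "nat \<Rightarrow> (nat \<Rightarrow> real^'nx) \<Rightarrow> ('nq \<Rightarrow> real) \<Rightarrow> real^'nr \<Rightarrow> real^'nu"
  stage_cost :: "nat \<Rightarrow> real^'nx \<Rightarrow> real^'nu \<Rightarrow> real^'nw \<Rightarrow> real^'nd \<Rightarrow> real"
  term_cost  :: "real^'nx \<Rightarrow> ('nw, 't) wseq \<Rightarrow> real^'nd \<Rightarrow> real"
  constr     :: "nat \<Rightarrow> real^'nx \<Rightarrow> real^'nu \<Rightarrow> real^'nw \<Rightarrow> real^'nd \<Rightarrow> real^'ng"
  W_set      :: "(real^'nw) set"
  D_set      :: "(real^'nd) set"

definition horizon ::
    "('nx::finite, 'nu::finite, 'nw::finite, 'nd::finite, 'nq::finite, 'nr::finite,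
      'ng::finite, 't::{finite,linorder}) rocp \<Rightarrow> nat" where
  "horizon P = CARD('t)"

definition at_time :: "('a, 't::{finite,linorder}) vec \<Rightarrow> nat \<Rightarrow> 'a" where
  "at_time w k = w $ (sorted_list_of_set UNIV ! k)"

definition W_seqs ::
    "('nx::finite, 'nu::finite, 'nw::finite, 'nd::finite, 'nq::finite, 'nr::finite,
      'ng::finite, 't::{finite,linorder}) rocp \<Rightarrow> ('nw, 't) wseq set" where
  "W_seqs P = {w. \<forall>k<horizon P. at_time w k \<in> W_set P}"

definition control ::
    "('nx::finite, 'nu::finite, 'nw::finite, 'nd::finite, 'nq::finite, 'nr::finite,
      'ng::finite, 't::{finite,linorder}) rocp \<Rightarrow>
     real^'nq \<Rightarrow> real^'nr \<Rightarrow> nat \<Rightarrow> (nat \<Rightarrow> real^'nx) \<Rightarrow> real^'nu" where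
  "control P q r k x =
     policy P k (restrict x {..k}) (restrict (\<lambda>j. q $ j) {j. q_block P j \<le> k}) r"

text \<open>States are indexed by \<open>{..N}\<close> and controls by \<open>{..<N}\<close>; the values outside these sets are
  normalised by extensionality, which makes the trajectory unique.\<close>

definition is_trajectory ::
    "('nx::finite, 'nu::finite, 'nw::finite, 'nd::finite, 'nq::finite, 'nr::finite,
      'ng::finite, 't::{finite,linorder}) rocp \<Rightarrow>
     real^'nq \<Rightarrow> real^'nr \<Rightarrow> ('nw, 't) wseq \<Rightarrow> real^'nd \<Rightarrow> ('nx, 'nu) traj \<Rightarrow> bool" where
  "is_trajectory P q r w d = (\<lambda>(x, u).
     x \<in> extensional {..horizon P} \<and> u \<in> extensional {..<horizon P} \<and>
     x 0 = init P \<and>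
     (\<forall>k<horizon P. x (Suc k) = dyn P k (x k) (u k) (at_time w k) d \<and> u k = control P q r k x))"

definition traj ::
    "('nx::finite, 'nu::finite, 'nw::finite, 'nd::finite, 'nq::finite, 'nr::finite,
      'ng::finite, 't::{finite,linorder}) rocp \<Rightarrow>
     real^'nq \<Rightarrow> real^'nr \<Rightarrow> ('nw, 't) wseq \<Rightarrow> real^'nd \<Rightarrow> ('nx, 'nu) traj" where
  "traj P q r w d = (THE xu. is_trajectory P q r w d xu)"

lemma ex1_trajectory: "\<exists>!xu. is_trajectory P q r w d xu"
proof -
  define F where "F k x = dyn P k (x k) (control P q r k x) (at_time w k) d" for k x
  have F_cong: "F k x = F k y" if "\<And>j. j \<le> k \<Longrightarrow> x j = y j" for k x y
  proof -
    have "restrict x {..k} = restrict y {..k}"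
      using that by (intro restrict_ext) auto
    with that[of k] show ?thesis
      by (simp add: F_def control_def)
  qed
  have "\<exists>x. x 0 = init P \<and> (\<forall>k<m. x (Suc k) = F k x)" for m
  proof (induction m)
    case 0
    show ?case by auto
  next
    case (Suc m)
    then obtain x where x: "x 0 = init P" "\<forall>k<m. x (Suc k) = F k x" by blast
    define y where "y = x(Suc m := F m x)"
    have "F k y = F k x" if "k \<le> m" for k
      using that by (intro F_cong) (auto simp: y_def)
    then have "y 0 = init P \<and> (\<forall>k<Suc m. y (Suc k) = F k y)"
      using x by (auto simp: y_def less_Suc_eq)
    then show ?case by blast
  qed
  then obtain x0 where x0: "x0 0 = init P" "\<forall>k<horizon P. x0 (Suc k) = F k x0" by blast
  define x where "x = restrict x0 {..horizon P}"
  define u where "u = restrict (\<lambda>k. control P q r k x) {..<horizon P}"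
  have "F k x = F k x0" if "k < horizon P" for k
    using that by (intro F_cong) (auto simp: x_def)
  then have "x (Suc k) = F k x" if "k < horizon P" for k
    using x0(2) that by (auto simp: x_def)
  then have ex: "is_trajectory P q r w d (x, u)"
    using x0(1) by (simp add: is_trajectory_def F_def u_def) (simp add: x_def)
  have "(y, v) = (y', v')"
    if t: "is_trajectory P q r w d (y, v)" and t': "is_trajectory P q r w d (y', v')"
    for y v y' v'
  proof -
    have yF: "y (Suc k) = F k y" "y' (Suc k) = F k y'" if "k < horizon P" for k
      using t t' that by (simp_all add: is_trajectory_def F_def)
    have eq: "k \<le> horizon P \<longrightarrow> y k = y' k" for k
    proof (induction k rule: less_induct)
      case (less k)
      show ?case
      proof (cases k)
        case 0
        then show ?thesis using t t' by (simp add: is_trajectory_def)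
      next
        case (Suc m)
        then show ?thesis using less yF[of m] F_cong[of m y y'] by auto
      qed
    qed
    have y: "y = y'"
      using t t' eq by (intro extensionalityI[of _ "{..horizon P}"]) (auto simp: is_trajectory_def)
    have "v = v'"
      using t t' y by (intro extensionalityI[of _ "{..<horizon P}"]) (auto simp: is_trajectory_def)
    with y show ?thesis by simp
  qed
  with ex show ?thesis by (metis surj_pair)
qed

lemma is_trajectory_traj: "is_trajectory P q r w d (traj P q r w d)"
  unfolding traj_def by (rule theI') (rule ex1_trajectory)

definition total_cost ::
    "('nx::finite, 'nu::finite, 'nw::finite, 'nd::finite, 'nq::finite, 'nr::finite,
      'ng::finite, 't::{finite,linorder}) rocp \<Rightarrow>
     ('nx, 'nu) traj \<Rightarrow> ('nw, 't) wseq \<Rightarrow> real^'nd \<Rightarrow> real" where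
  "total_cost P = (\<lambda>(x, u) w d.
     term_cost P (x (horizon P)) w d +
     (\<Sum>k<horizon P. stage_cost P k (x k) (u k) (at_time w k) d))"

definition G ::
    "('nx::finite, 'nu::finite, 'nw::finite, 'nd::finite, 'nq::finite, 'nr::finite,
      'ng::finite, 't::{finite,linorder}) rocp \<Rightarrow>
     ('nx, 'nu) traj \<Rightarrow> ('nw, 't) wseq \<Rightarrow> real^'nd \<Rightarrow> real \<Rightarrow> real" where
  "G P xu w d \<gamma> =
     max (MAX (h, k) \<in> UNIV \<times> {..<horizon P}.
            axis h 1 \<bullet> constr P k (fst xu k) (snd xu k) (at_time w k) d)
         (total_cost P xu w d - \<gamma>)"

text \<open>Boundedness of the trajectories is required for each fixed parameter \<open>(q, r)\<close>, uniformly over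
  all uncertainties in \<open>\<W>\<^sup>N \<times> \<D>\<close>.\<close>

definition well_posed ::
    "('nx::finite, 'nu::finite, 'nw::finite, 'nd::finite, 'nq::finite, 'nr::finite,
      'ng::finite, 't::{finite,linorder}) rocp \<Rightarrow> bool" where
  "well_posed P \<longleftrightarrow>
     W_set P \<noteq> {} \<and> compact (W_set P) \<and> D_set P \<noteq> {} \<and> compact (D_set P) \<and>
     (\<forall>j. q_block P j < horizon P) \<and>
     (\<forall>k<horizon P.
        continuously_differentiable (\<lambda>(x, u, w, d). dyn P k x u w d) \<and>
        continuously_differentiable (\<lambda>(x, u, w, d). stage_cost P k x u w d) \<and>
        continuously_differentiable (\<lambda>(x, u, w, d). constr P k x u w d)) \<and>
     continuously_differentiable (\<lambda>(x, w, d). term_cost P x w d) \<and>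
     (\<forall>q r.
        bounded {fst (traj P q r w d) k |w d k. w \<in> W_seqs P \<and> d \<in> D_set P \<and> k \<le> horizon P} \<and>
        bounded {snd (traj P q r w d) k |w d k. w \<in> W_seqs P \<and> d \<in> D_set P \<and> k < horizon P})"


section \<open>The robust problem and its semi-infinite reformulation\<close>

definition componentwise_nonpos :: "real^'n \<Rightarrow> bool" where
  "componentwise_nonpos v \<longleftrightarrow> (\<forall>h. v $ h \<le> 0)"

text \<open>Decision variables are \<open>(q, r, (x\<^sup>i, u\<^sup>i)\<^sub>i\<^sub>\<in>\<^sub>J)\<close>; the family is a function on the index type
  of which only the values on \<open>J\<close> matter.\<close>

definition robust_feasible ::
    "('nx::finite, 'nu::finite, 'nw::finite, 'nd::finite, 'nq::finite, 'nr::finite,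
      'ng::finite, 't::{finite,linorder}) rocp \<Rightarrow>
     'i set \<Rightarrow> ('i \<Rightarrow> ('nw, 't) wseq) \<Rightarrow> ('i \<Rightarrow> real^'nd) \<Rightarrow>
     ((real^'nq) \<times> (real^'nr) \<times> ('i \<Rightarrow> ('nx, 'nu) traj)) set" where
  "robust_feasible P J w d = {(q, r, X).
     (\<forall>i\<in>J. \<forall>k<horizon P. componentwise_nonpos
        (constr P k (fst (X i) k) (snd (X i) k) (at_time (w i) k) (d i))) \<and>
     (\<forall>i\<in>J. X i = traj P q r (w i) (d i))}"

definition robust_cost ::
    "('nx::finite, 'nu::finite, 'nw::finite, 'nd::finite, 'nq::finite, 'nr::finite,
      'ng::finite, 't::{finite,linorder}) rocp \<Rightarrow>
     'i set \<Rightarrow> ('i \<Rightarrow> ('nw, 't) wseq) \<Rightarrow> ('i \<Rightarrow> real^'nd) \<Rightarrow>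
     (real^'nq) \<times> (real^'nr) \<times> ('i \<Rightarrow> ('nx, 'nu) traj) \<Rightarrow> ereal" where
  "robust_cost P J w d = (\<lambda>(q, r, X). SUP i\<in>J. ereal (total_cost P (X i) (w i) (d i)))"

definition Q :: "'a \<times> 'b \<times> real \<Rightarrow> real" where
  "Q = (\<lambda>(q, r, \<gamma>). \<gamma>)"

definition R ::
    "('nx::finite, 'nu::finite, 'nw::finite, 'nd::finite, 'nq::finite, 'nr::finite,
      'ng::finite, 't::{finite,linorder}) rocp \<Rightarrow>
     (real^'nq) \<times> (real^'nr) \<times> real \<Rightarrow> ('nw, 't) wseq \<times> (real^'nd) \<Rightarrow> real" where
  "R P = (\<lambda>(q, r, \<gamma>) (w, d). G P (traj P q r w d) w d \<gamma>)"

end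

theory Submission
  imports Defs
begin

text \<open>The scalar \<open>\<gamma>\<close> ranges over the finite upper bounds of the worst-case cost: a point \<open>(q, r, \<gamma>)\<close>
  satisfies the semi-infinite constraint iff \<open>(q, r)\<close> with its trajectories is robustly feasible and
  has worst-case cost at most \<open>\<gamma>\<close>.  As the worst-case cost is never \<open>-\<infinity>\<close>, the smallest such
  \<open>\<gamma>\<close> is that cost itself whenever it is finite, and there is none otherwise.\<close>

lemma horizon_pos: "0 < horizon P"
  by (simp add: horizon_def card_gt_0_iff)

text \<open>A maximum of finitely many reals is nonpositive iff each of them is, and the inner
  product with \<open>axis h 1\<close> extracts component \<open>h\<close>.\<close>

lemma G_nonpos_iff:
  "G P xu w d \<gamma> \<le> 0 \<longleftrightarrow>
     (\<forall>k<horizon P. componentwise_nonpos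
        (constr P k (fst xu k) (snd xu k) (at_time w k) d)) \<and>
     total_cost P xu w d \<le> \<gamma>"
proof -
  \<comment> \<open>\<open>Max\<close> is characterised only on nonempty finite sets; this is where
    a horizon of at least one matters.\<close>
  have "UNIV \<times> {..<horizon P} \<noteq> {}"
    using horizon_pos[of P] by auto
  then show ?thesis
    by (auto simp: G_def componentwise_nonpos_def inner_axis' split_beta)
qed

lemma robust_feasible_iff:
  "(q, r, X) \<in> robust_feasible P J w d \<longleftrightarrow>
     (\<forall>i\<in>J. \<forall>k<horizon P. componentwise_nonpos
        (constr P k (fst (X i) k) (snd (X i) k) (at_time (w i) k) (d i))) \<and>
     (\<forall>i\<in>J. X i = traj P q r (w i) (d i))"
  by (simp add: robust_feasible_def)

text \<open>The bounds on the individual costs merge into one bound on their supremum. Fixing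
  \<open>X\<close> on \<open>J\<close> suffices, since neither side depends on its values
  elsewhere.\<close>

lemma sip_feasible_iff_robust_feasible:
  assumes "\<forall>i\<in>J. X i = traj P q r (w i) (d i)"
  shows "(q, r, \<gamma>) \<in> sip_feasible UNIV ((\<lambda>i. (w i, d i)) ` J) (R P) \<longleftrightarrow>
    (q, r, X) \<in> robust_feasible P J w d \<and> robust_cost P J w d (q, r, X) \<le> ereal \<gamma>"
  using assms
  by (auto simp: sip_feasible_def R_def G_nonpos_iff robust_feasible_iff robust_cost_def
      SUP_le_iff)

text \<open>The supremum dominates one real cost; over an empty index set it would be
  -\<infinity>.\<close>

lemma robust_cost_neq_MInfty:
  assumes "J \<noteq> {}"
  shows "robust_cost P J w d s \<noteq> -\<infinity>"
proof -
  obtain q r X where s: "s = (q, r, X)"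
    by (cases s)
  from assms obtain i where "i \<in> J"
    by blast
  then have "ereal (total_cost P (X i) (w i) (d i)) \<le> robust_cost P J w d s"
    unfolding s robust_cost_def by (auto intro: SUP_upper)
  then show ?thesis
    by auto
qed

text \<open>Each feasible point of one problem has its cost bounded below by the optimal value of
  the other, because it either yields a point there of no larger cost or costs \<infinity>.\<close>

lemma optimal_value_robust_eq_sip:
  assumes "J \<noteq> {}"
  shows "optimal_value (robust_feasible P J w d) (robust_cost P J w d) =
    optimal_value (sip_feasible UNIV ((\<lambda>i. (w i, d i)) ` J) (R P)) (\<lambda>\<theta>. ereal (Q \<theta>))"
    (is "optimal_value ?FP ?cP = optimal_value ?FS ?cS")
proof (rule antisym)
  show "optimal_value ?FP ?cP \<le> optimal_value ?FS ?cS"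
    unfolding optimal_value_def
  proof (rule INF_greatest)
    fix \<theta> assume \<theta>_feas: "\<theta> \<in> ?FS"
    obtain q r \<gamma> where \<theta>: "\<theta> = (q, r, \<gamma>)"
      by (cases \<theta>)
    let ?s = "(q, r, \<lambda>i. traj P q r (w i) (d i))"
    have "?s \<in> ?FP \<and> ?cP ?s \<le> ereal \<gamma>"
      using \<theta>_feas unfolding \<theta> by (subst (asm) sip_feasible_iff_robust_feasible) simp_all
    then have "(INF s\<in>?FP. ?cP s) \<le> ereal \<gamma>"
      by (blast intro: INF_lower2)
    then show "(INF s\<in>?FP. ?cP s) \<le> ereal (Q \<theta>)"
      by (simp add: \<theta> Q_def)
  qed
next
  show "optimal_value ?FS ?cS \<le> optimal_value ?FP ?cP"
    unfolding optimal_value_def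
  proof (rule INF_greatest)
    fix s assume s: "s \<in> ?FP"
    obtain q r X where s_eq: "s = (q, r, X)"
      by (cases s)
    \<comment> \<open>Only a finite cost can serve as \<gamma>; for cost \<infinity> the bound is
      trivial.\<close>
    show "(INF \<theta>\<in>?FS. ereal (Q \<theta>)) \<le> ?cP s"
    proof (cases "?cP s")
      case (real \<gamma>)
      have "\<forall>i\<in>J. X i = traj P q r (w i) (d i)"
        using s by (simp add: s_eq robust_feasible_iff)
      from sip_feasible_iff_robust_feasible[OF this] have "(q, r, \<gamma>) \<in> ?FS"
        using s real unfolding s_eq by simp
      then have "(INF \<theta>\<in>?FS. ereal (Q \<theta>)) \<le> ereal (Q (q, r, \<gamma>))"
        by (rule INF_lower)
      then show ?thesis
        by (simp add: real Q_def)
    next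
      case MInf
      then show ?thesis
        using robust_cost_neq_MInfty[OF assms, of P w d s] by simp
    qed simp
  qed
qed

text \<open>With equal optimal values, the only possible \<gamma> is the worst-case cost itself, and
  \<gamma> being real corresponds to that cost being finite.\<close>

lemma robust_minimizer_iff_sip_minimizer:
  assumes "J \<noteq> {}" and X: "\<forall>i\<in>J. X i = traj P q r (w i) (d i)"
  shows "is_minimizer (robust_feasible P J w d) (robust_cost P J w d) (q, r, X) \<and>
      \<bar>robust_cost P J w d (q, r, X)\<bar> \<noteq> \<infinity> \<longleftrightarrow>
    (\<exists>\<gamma>. is_minimizer (sip_feasible UNIV ((\<lambda>i. (w i, d i)) ` J) (R P))
      (\<lambda>\<theta>. ereal (Q \<theta>)) (q, r, \<gamma>))"
    (is "is_minimizer ?FP ?cP _ \<and> _ \<longleftrightarrow> (\<exists>\<gamma>. is_minimizer ?FS ?cS _)")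
proof
  note val = optimal_value_robust_eq_sip[OF \<open>J \<noteq> {}\<close>, of P w d]
  note feas = sip_feasible_iff_robust_feasible[OF X]
  show "\<exists>\<gamma>. is_minimizer ?FS ?cS (q, r, \<gamma>)"
    if "is_minimizer ?FP ?cP (q, r, X) \<and> \<bar>?cP (q, r, X)\<bar> \<noteq> \<infinity>"
  proof -
    from that obtain \<gamma> where "?cP (q, r, X) = ereal \<gamma>"
      by (cases "?cP (q, r, X)") simp_all
    with that have "is_minimizer ?FS ?cS (q, r, \<gamma>)"
      unfolding is_minimizer_def feas val by (simp add: Q_def)
    then show ?thesis ..
  qed
  show "is_minimizer ?FP ?cP (q, r, X) \<and> \<bar>?cP (q, r, X)\<bar> \<noteq> \<infinity>"
    if "\<exists>\<gamma>. is_minimizer ?FS ?cS (q, r, \<gamma>)"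
  proof -
    from that obtain \<gamma> where opt: "(q, r, X) \<in> ?FP" "?cP (q, r, X) \<le> ereal \<gamma>"
      "ereal \<gamma> = optimal_value ?FP ?cP"
      unfolding is_minimizer_def feas val by (auto simp: Q_def)
    \<comment> \<open>Feasibility alone gives only cost at most \<gamma>; as \<gamma> is the optimal
      value, this reverse bound forces equality.\<close>
    have "optimal_value ?FP ?cP \<le> ?cP (q, r, X)"
      unfolding optimal_value_def by (rule INF_lower) (rule opt)
    with opt have "?cP (q, r, X) = ereal \<gamma>"
      by simp
    then show ?thesis
      using opt(1) by (simp add: is_minimizer_def flip: opt(3))
  qed
qed

theorem theorem2p1:
  fixes P :: "('nx::finite, 'nu::finite, 'nw::finite, 'nd::finite, 'nq::finite, 'nr::finite,
               'ng::finite, 't::{finite,linorder}) rocp"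
    and H :: "(('nw, 't) wseq \<times> (real^'nd)) set"
    and J :: "'i set" and w :: "'i \<Rightarrow> ('nw, 't) wseq" and d :: "'i \<Rightarrow> real^'nd"
  defines "F\<^sub>P \<equiv> robust_feasible P J w d"
    and "c\<^sub>P \<equiv> robust_cost P J w d"
    and "F\<^sub>S \<equiv> sip_feasible UNIV H (R P)"
    and "c\<^sub>S \<equiv> (\<lambda>\<theta>. ereal (Q \<theta>))"
  assumes "well_posed P"
    and "H \<noteq> {}" and "H \<subseteq> W_seqs P \<times> D_set P"
    and "(\<lambda>i. (w i, d i)) ` J = H" and "J \<approx> H"
  shows "optimal_value F\<^sub>P c\<^sub>P = optimal_value F\<^sub>S c\<^sub>S \<and>
    (\<forall>q r X. (\<forall>i\<in>J. X i = traj P q r (w i) (d i)) \<longrightarrow>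
       (is_minimizer F\<^sub>P c\<^sub>P (q, r, X) \<and> \<bar>c\<^sub>P (q, r, X)\<bar> \<noteq> \<infinity>) =
       (\<exists>\<gamma>::real. is_minimizer F\<^sub>S c\<^sub>S (q, r, \<gamma>)))"
proof -
  have "J \<noteq> {}"
    using assms by auto
  moreover have H: "H = (\<lambda>i. (w i, d i)) ` J"
    using assms by simp
  ultimately show ?thesis
    unfolding F\<^sub>P_def c\<^sub>P_def F\<^sub>S_def c\<^sub>S_def H
    by (intro conjI allI impI optimal_value_robust_eq_sip robust_minimizer_iff_sip_minimizer)
qed

end
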